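(* For any $m,m'\in\mathbb N$ with $m'\ge m$, $\Lambda_{\mathscr F_{m'},\mathscr F_m}\le\frac{m'}{m}$.
   Context: Uniform price auction with $K$ identical units, repeated over a finite bid history $\mathcal H=[\boldsymbol\beta_-^t]_{t\in[T]}$ of competing bids. A bidder has valuation $\mathbf v$: $v_1\ge\dots\ge v_M>0$. An $m$-uniform strategy $\langle(b_1,q_1),\dots,(b_m,q_m)\rangle$ ($b_1>\dots>b_m>0$, positive integer $q_j$, $\sum_jq_j\le M$) is the bid vector with $q_1$ copies of $b_1$, then $q_2$ copies of $b_2$, etc. With competing bids $\boldsymbol\beta_-$, the $K$ highest bids win a unit each (ties in favor of the bidder), $x$ is the bidder's number of winning bids, the price $p$ is the $K$-th highest bid, $V(\mathbf b;\boldsymbol\beta_-)=\sum_{j\le x}v_j$, $P=px$. $\mathscr F_m=\mathscr F_m(\mathcal H)$ is the class of $k$-uniform strategies with $k\le m$ that are RoI feasible ($V\ge P$) in every round of $\mathcal H$. $\Lambda_{\mathscr F_{m'},\mathscr F_m}(\mathcal H,\mathbf v)=\frac{\max_{\mathbf b\in\mathscr F_{m'}(\mathcal H)}\sum_tV(\mathbf b;\boldsymbol\beta_-^t)}{\max_{\mathbf b'\in\mathscr F_m(\mathcal H)}\sum_tV(\mathbf b';\boldsymbol\beta_-^t)}$ and $\Lambda_{\mathscr F_{m'},\mathscr F_m}$ is the supremum over all valuation vectors and bid histories of arbitrary length. *)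

theory Defs
  imports Complex_Main "HOL-Library.Multiset" "HOL-Library.Extended_Real"
begin

text \<open>
  The bidder's valuation and bid vectors are lists, indexed from 0 (so \<open>v ! 0\<close> is \<open>v\<^sub>1\<close>);
  the competing bids of a round are a finite multiset of arbitrary size;
  a bid history is the list of the competing bids of its rounds.
\<close>

type_synonym bids = "real list"
type_synonym history = "real multiset list"

definition valuation :: "nat \<Rightarrow> real list \<Rightarrow> bool" where
  "valuation M v \<longleftrightarrow> length v = M \<and> sorted_wrt (\<ge>) v \<and> (\<forall>a\<in>set v. a > 0)"

definition bid_history :: "history \<Rightarrow> bool" where
  "bid_history H \<longleftrightarrow> H \<noteq> [] \<and> (\<forall>B\<in>set H. \<forall>c\<in>#B. c \<ge> 0)"

definition uniform_strategy :: "nat \<Rightarrow> nat \<Rightarrow> (real \<times> nat) list \<Rightarrow> bool" where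
  "uniform_strategy M k s \<longleftrightarrow>
     length s = k \<and> sorted_wrt (>) (map fst s) \<and>
     (\<forall>(b, q)\<in>set s. b > 0 \<and> q > 0) \<and> sum_list (map snd s) \<le> M"

definition bid_vector :: "(real \<times> nat) list \<Rightarrow> bids" where
  "bid_vector s = concat (map (\<lambda>(b, q). replicate q b) s)"

text \<open>
  For a non-increasing bid vector \<open>b\<close>, the bids ranked ahead of \<open>b ! j\<close> are the \<open>j\<close> earlier
  bids of the bidder and, ties being broken in favor of the bidder, the strictly higher
  competing bids.
\<close>

definition wins :: "nat \<Rightarrow> bids \<Rightarrow> real multiset \<Rightarrow> nat \<Rightarrow> bool" where
  "wins K b B j \<longleftrightarrow> j + size {#c \<in># B. c > b ! j#} < K"

definition num_won :: "nat \<Rightarrow> bids \<Rightarrow> real multiset \<Rightarrow> nat" where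
  "num_won K b B = card {j. j < length b \<and> wins K b B j}"

text \<open>Absent bids count as zero bids, so the price is 0 if fewer than \<open>K\<close> bids are submitted.\<close>

definition kth_highest :: "nat \<Rightarrow> real multiset \<Rightarrow> real" where
  "kth_highest k A = (if k \<le> size A then rev (sorted_list_of_multiset A) ! (k - 1) else 0)"

definition price :: "nat \<Rightarrow> bids \<Rightarrow> real multiset \<Rightarrow> real" where
  "price K b B = kth_highest K (mset b + B)"

definition total_value :: "nat \<Rightarrow> real list \<Rightarrow> bids \<Rightarrow> real multiset \<Rightarrow> real" where
  "total_value K v b B = (\<Sum>j<num_won K b B. v ! j)"

definition payment :: "nat \<Rightarrow> bids \<Rightarrow> real multiset \<Rightarrow> real" where
  "payment K b B = price K b B * real (num_won K b B)"

definition roi_feasible :: "nat \<Rightarrow> real list \<Rightarrow> history \<Rightarrow> bids \<Rightarrow> bool" where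
  "roi_feasible K v H b \<longleftrightarrow> (\<forall>B\<in>set H. total_value K v b B \<ge> payment K b B)"

definition feasible_class :: "nat \<Rightarrow> nat \<Rightarrow> real list \<Rightarrow> history \<Rightarrow> nat \<Rightarrow> bids set" where
  "feasible_class K M v H m =
     {bid_vector s | s k. 1 \<le> k \<and> k \<le> m \<and> uniform_strategy M k s \<and> roi_feasible K v H (bid_vector s)}"

definition history_value :: "nat \<Rightarrow> real list \<Rightarrow> history \<Rightarrow> bids \<Rightarrow> real" where
  "history_value K v H b = (\<Sum>B\<leftarrow>H. total_value K v b B)"

definition optimal_value :: "nat \<Rightarrow> nat \<Rightarrow> real list \<Rightarrow> history \<Rightarrow> nat \<Rightarrow> real" where
  "optimal_value K M v H m = Max (history_value K v H ` feasible_class K M v H m)"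

text \<open>
  The ratio is taken in the extended reals, where \<open>a / 0 = \<infinity>\<close> for \<open>a > 0\<close>
  and \<open>0 / 0 = 0\<close> (no strategy in either class ever wins a unit).
\<close>

definition value_ratio :: "nat \<Rightarrow> nat \<Rightarrow> nat \<Rightarrow> nat \<Rightarrow> history \<Rightarrow> real list \<Rightarrow> ereal" where
  "value_ratio K M m' m H v =
     ereal (optimal_value K M v H m') / ereal (optimal_value K M v H m)"

definition Lambda :: "nat \<Rightarrow> nat \<Rightarrow> nat \<Rightarrow> nat \<Rightarrow> ereal" where
  "Lambda K M m' m = (SUP (v, H) \<in> {(v, H). valuation M v \<and> bid_history H}. value_ratio K M m' m H v)"

text \<open>
  The maximum in \<open>optimal_value\<close> ranges over a finite nonempty set of reals, although the
  class of strategies itself is infinite in general.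
\<close>

lemma length_bid_vector: "length (bid_vector s) = sum_list (map snd s)"
  by (induction s) (auto simp: bid_vector_def)

lemma num_won_le: "num_won K b B \<le> length b"
proof -
  have "num_won K b B \<le> card {..<length b}"
    unfolding num_won_def by (rule card_mono) auto
  then show ?thesis by simp
qed

lemma finite_history_values: "finite (history_value K v H ` feasible_class K M v H m)"
proof -
  let ?A = "(\<lambda>n. \<Sum>j<n. v ! j) ` {..M}"
  have "history_value K v H ` feasible_class K M v H m
    \<subseteq> sum_list ` {xs. set xs \<subseteq> ?A \<and> length xs = length H}"
  proof clarify
    fix b assume "b \<in> feasible_class K M v H m"
    then have "length b \<le> M"
      by (auto simp: feasible_class_def uniform_strategy_def length_bid_vector)
    then have "num_won K b B \<le> M" for B
      using num_won_le order_trans by blast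
    then have "set (map (total_value K v b) H) \<subseteq> ?A"
      by (auto simp: total_value_def)
    then show "history_value K v H b \<in> sum_list ` {xs. set xs \<subseteq> ?A \<and> length xs = length H}"
      unfolding history_value_def
      by (intro imageI CollectI conjI) simp_all
  qed
  then show ?thesis
    by (rule finite_subset) (intro finite_imageI finite_lists_length_eq finite_atMost)
qed

lemma kth_highest_le:
  assumes "K \<ge> 1" and "size {#c \<in># A. c > a#} < K" and "a \<ge> 0"
  shows "kth_highest K A \<le> a"
proof (cases "K \<le> size A")
  case True
  define L where "L = rev (sorted_list_of_multiset A)"
  have mL: "mset L = A" by (simp add: L_def)
  then have lL: "length L = size A" by (metis size_mset)
  have sL: "L ! j \<le> L ! i" if "i \<le> j" "j < length L" for i j
    using that sorted_rev_nth_mono[of L i j] by (simp add: L_def)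
  have "L ! (K - 1) \<le> a"
  proof (rule ccontr)
    assume "\<not> L ! (K - 1) \<le> a"
    then have "L ! i > a" if "i < K" for i
      using that sL[of i "K - 1"] True lL by fastforce
    then have "{..<K} \<subseteq> {i. i < length L \<and> L ! i > a}"
      using True lL by auto
    then have "K \<le> card {i. i < length L \<and> L ! i > a}"
      using card_mono[of "{i. i < length L \<and> L ! i > a}" "{..<K}"] by simp
    also have "\<dots> = size {#c \<in># A. c > a#}"
      using length_filter_conv_card[of "\<lambda>c. c > a" L] mL by (metis mset_filter size_mset)
    finally show False using assms by simp
  qed
  with True show ?thesis by (simp add: kth_highest_def L_def)
qed (use assms in \<open>simp add: kth_highest_def\<close>)

lemma feasible_class_nonempty:
  assumes "K \<ge> 1" "M \<ge> 1" "m \<ge> 1" "valuation M v"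
  shows "feasible_class K M v H m \<noteq> {}"
proof -
  let ?s = "[(v ! 0, 1 :: nat)]"
  have pos: "v ! 0 > 0"
    using assms by (auto simp: valuation_def)
  have b: "bid_vector ?s = [v ! 0]"
    by (simp add: bid_vector_def)
  have "payment K [v ! 0] B \<le> total_value K v [v ! 0] B" for B
  proof (cases "wins K [v ! 0] B 0")
    case True
    then have "num_won K [v ! 0] B = 1"
      by (simp add: num_won_def conj_commute cong: conj_cong)
    moreover have "price K [v ! 0] B \<le> v ! 0"
      unfolding price_def using True assms pos
      by (intro kth_highest_le) (auto simp: wins_def)
    ultimately show ?thesis by (simp add: payment_def total_value_def)
  next
    case False
    then have "num_won K [v ! 0] B = 0"
      by (auto simp: num_won_def)
    then show ?thesis by (simp add: payment_def total_value_def)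
  qed
  then have "roi_feasible K v H (bid_vector ?s)"
    unfolding roi_feasible_def b by simp
  moreover have "uniform_strategy M 1 ?s"
    using pos assms by (simp add: uniform_strategy_def)
  ultimately have "bid_vector ?s \<in> feasible_class K M v H m"
    unfolding feasible_class_def using assms by blast
  then show ?thesis by blast
qed

end

(*
  Lowering bids pointwise can only lower the price and the number of units won, and the average
  value of the first x units is non-increasing in x, so RoI feasibility survives.  Lowering one
  block of a (k+1)-uniform strategy to the bid of the next block (or deleting it, if it is the last
  one) yields a feasible k-uniform strategy that wins as much as before in every round whose last
  winning bid lies outside that block.  Each round has its last winning bid in at most one block, so
  some choice of the block keeps a fraction k/(k+1) of the value; iterating, the factors telescope.
*)
theory Submission imports Defs begin

section \<open>The K-th highest bid and monotonicity of the price\<close>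

lemma kth_highest_nonneg:
  assumes "\<forall>c\<in>#A. c \<ge> 0" and "k \<ge> 1"
  shows "kth_highest k A \<ge> 0"
proof (cases "k \<le> size A")
  case True
  have "mset (rev (sorted_list_of_multiset A)) = A" by simp
  then have "rev (sorted_list_of_multiset A) ! (k - 1) \<in># A"
    using True assms(2)
    by (metis One_nat_def Suc_le_lessD Suc_pred nth_mem set_mset_mset size_mset)
  then show ?thesis using True assms by (simp add: kth_highest_def)
qed (simp add: kth_highest_def)

text \<open>Together with \<open>kth_highest_le\<close>, this makes the k-th highest of nonnegative
  bids the least nonnegative number that fewer than \<open>k\<close> bids exceed. Prices can then be
  compared by counting bids instead of sorting them.\<close>

lemma size_above_kth_highest:
  assumes "k \<ge> 1"
  shows "size {#c \<in># A. c > kth_highest k A#} < k"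
proof (cases "k \<le> size A")
  case True
  define L where "L = rev (sorted_list_of_multiset A)"
  have mL: "mset L = A" by (simp add: L_def)
  then have lL: "length L = size A" by (metis size_mset)
  have "{i. i < length L \<and> L ! i > L ! (k - 1)} \<subseteq> {..<k - 1}"
  proof clarify
    fix i assume i: "i < length L" "L ! i > L ! (k - 1)"
    show "i < k - 1"
    proof (rule ccontr)
      assume "\<not> i < k - 1"
      then have "L ! i \<le> L ! (k - 1)"
        using i(1) sorted_rev_nth_mono[of L "k - 1" i] by (simp add: L_def)
      with i(2) show False by simp
    qed
  qed
  then have "card {i. i < length L \<and> L ! i > L ! (k - 1)} \<le> k - 1"
    using card_mono[of "{..<k - 1}"] by fastforce
  moreover have "card {i. i < length L \<and> L ! i > L ! (k - 1)} = size {#c \<in># A. c > L ! (k - 1)#}"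
    using length_filter_conv_card[of "\<lambda>c. c > L ! (k - 1)" L] mL by (metis mset_filter size_mset)
  moreover have "kth_highest k A = L ! (k - 1)"
    using True by (simp add: kth_highest_def L_def)
  ultimately show ?thesis using assms by simp
next
  case False
  then show ?thesis
    using size_filter_mset_lesseq[of "\<lambda>c. c > kth_highest k A" A] by linarith
qed

text \<open>The lower vector may be shorter, so that deleting bids from the end also counts as
  lowering them.\<close>

definition below :: "bids \<Rightarrow> bids \<Rightarrow> bool" where
  "below b' b \<longleftrightarrow> length b' \<le> length b \<and> (\<forall>j<length b'. b' ! j \<le> b ! j)"

text \<open>Each bid of \<open>b'\<close> above the old price has a bid of \<open>b\<close> above it
  at the same position. So still fewer than \<open>K\<close> bids exceed the old price, which
  therefore bounds the new one.\<close>

lemma price_mono: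
  assumes "below b' b" and "\<forall>c\<in>set b. c \<ge> 0" and "\<forall>c\<in>#B. c \<ge> 0" and "K \<ge> 1"
  shows "price K b' B \<le> price K b B"
proof -
  let ?p = "price K b B"
  have "{i. i < length b' \<and> b' ! i > ?p} \<subseteq> {i. i < length b \<and> b ! i > ?p}"
    using assms(1) by (fastforce simp: below_def)
  then have "card {i. i < length b' \<and> b' ! i > ?p} \<le> card {i. i < length b \<and> b ! i > ?p}"
    by (intro card_mono) auto
  then have "size {#c \<in># mset b'. c > ?p#} \<le> size {#c \<in># mset b. c > ?p#}"
    by (metis length_filter_conv_card mset_filter size_mset)
  moreover have "size {#c \<in># mset b + B. c > ?p#} < K"
    unfolding price_def by (rule size_above_kth_highest) fact
  ultimately have "size {#c \<in># mset b' + B. c > ?p#} < K" by simp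
  moreover have "?p \<ge> 0"
    unfolding price_def by (rule kth_highest_nonneg) (use assms in auto)
  ultimately show ?thesis
    unfolding price_def[of K b'] by (intro kth_highest_le) (use assms in auto)
qed

section \<open>Units won and their value\<close>

lemma num_won_mono:
  assumes "below b' b"
  shows "num_won K b' B \<le> num_won K b B"
  unfolding num_won_def
proof (rule card_mono)
  show "{j. j < length b' \<and> wins K b' B j} \<subseteq> {j. j < length b \<and> wins K b B j}"
  proof clarify
    fix j assume j: "j < length b'" "wins K b' B j"
    then have "{#c \<in># B. c > b ! j#} \<subseteq># {#c \<in># B. c > b' ! j#}"
      using assms by (intro filter_mset_mono_strong) (fastforce simp: below_def)+
    then have "size {#c \<in># B. c > b ! j#} \<le> size {#c \<in># B. c > b' ! j#}"
      by (rule size_mset_mono)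
    then show "j < length b \<and> wins K b B j"
      using j assms by (auto simp: wins_def below_def)
  qed
qed simp

text \<open>An earlier position has fewer own bids ahead of it and, its bid being at least as high,
  no more competing ones. So the winning positions are closed downwards, and such a finite set is
  the initial segment of its own cardinality.\<close>

lemma wins_set_eq:
  assumes "sorted_wrt (\<ge>) b"
  shows "{j. j < length b \<and> wins K b B j} = {..<num_won K b B}"
proof -
  let ?W = "{j. j < length b \<and> wins K b B j}"
  have down: "i \<in> ?W" if "j \<in> ?W" "i \<le> j" for i j
  proof -
    have "b ! j \<le> b ! i"
      using that assms by (cases "i = j") (auto simp: sorted_wrt_iff_nth_less)
    then have "size {#c \<in># B. c > b ! i#} \<le> size {#c \<in># B. c > b ! j#}"
      by (intro size_mset_mono filter_mset_mono_strong) auto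
    then show ?thesis using that by (auto simp: wins_def)
  qed
  have "?W \<subseteq> {..<card ?W}"
  proof
    fix j assume "j \<in> ?W"
    then have "{..j} \<subseteq> ?W" using down by blast
    then have "card {..j} \<le> card ?W" by (intro card_mono) auto
    then show "j \<in> {..<card ?W}" by simp
  qed
  then have "?W = {..<card ?W}" by (intro card_subset_eq) auto
  then show ?thesis unfolding num_won_def .
qed

text \<open>Whether position \<open>n\<close> wins depends only on \<open>n\<close>, the bid placed
  there and the competing bids. An unchanged last winning bid thus still wins, and by
  \<open>wins_set_eq\<close> all positions before it win as well.\<close>

lemma num_won_ge_if_last_win_kept:
  assumes "sorted_wrt (\<ge>) b" "sorted_wrt (\<ge>) b'" and "num_won K b B = Suc n"
    and "n < length b'" and "b' ! n = b ! n"
  shows "num_won K b B \<le> num_won K b' B"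
proof -
  have "n \<in> {j. j < length b \<and> wins K b B j}"
    unfolding wins_set_eq[OF assms(1)] using assms(3) by simp
  then have "n \<in> {j. j < length b' \<and> wins K b' B j}"
    using assms(4,5) by (simp add: wins_def)
  then show ?thesis
    unfolding wins_set_eq[OF assms(2)] using assms(3) by simp
qed

lemma total_value_mono:
  assumes "valuation M v" and "length b' \<le> M" and "num_won K b B \<le> num_won K b' B"
  shows "total_value K v b B \<le> total_value K v b' B"
  unfolding total_value_def
proof (rule sum_mono2)
  fix j assume "j \<in> {..<num_won K b' B} - {..<num_won K b B}"
  then have "j < length v"
    using assms num_won_le[of K b' B] by (auto simp: valuation_def)
  then show "0 \<le> v ! j"
    using assms(1) by (auto simp: valuation_def intro: less_imp_le)
qed (use assms in auto)

lemma total_value_nonneg: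
  assumes "valuation M v" and "length b \<le> M"
  shows "total_value K v b B \<ge> 0"
  unfolding total_value_def
proof (rule sum_nonneg)
  fix j assume "j \<in> {..<num_won K b B}"
  then have "j < length v"
    using assms num_won_le[of K b B] by (auto simp: valuation_def)
  then show "0 \<le> v ! j"
    using assms(1) by (auto simp: valuation_def intro: less_imp_le)
qed

section \<open>RoI feasibility of lowered bids\<close>

lemma average_value_antimono:
  assumes "valuation M v" and "x' \<le> x" and "x \<le> M"
  shows "real x' * (\<Sum>j<x. v ! j) \<le> real x * (\<Sum>j<x'. v ! j)"
  using assms(2,3)
proof (induction x rule: dec_induct)
  case (step n)
  \<comment> \<open>Going from \<open>n\<close> to \<open>Suc n\<close> adds \<open>x'\<close>
    copies of \<open>v ! n\<close> on the left and the first \<open>x'\<close> values on the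
    right.\<close>
  have "v ! n \<le> v ! j" if "j < x'" for j
    using that step assms(1) by (auto simp: valuation_def sorted_wrt_iff_nth_less)
  then have "(\<Sum>j<x'. v ! n) \<le> (\<Sum>j<x'. v ! j)" by (intro sum_mono) auto
  with step show ?case by (simp add: algebra_simps)
qed simp

text \<open>Feasibility in a round with a win says that the price is at most the average value of
  the units won. Lowering the bids does not raise the price and, while a unit is still won, does not
  lower this average.\<close>

lemma roi_feasible_below:
  assumes "roi_feasible K v H b" and "below b' b" and "\<forall>c\<in>set b. c \<ge> 0"
    and "bid_history H" and "valuation M v" and "length b \<le> M" and "K \<ge> 1"
  shows "roi_feasible K v H b'"
  unfolding roi_feasible_def
proof
  fix B assume B: "B \<in> set H"
  let ?x = "num_won K b B" and ?x' = "num_won K b' B"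
  have le: "?x' \<le> ?x" by (rule num_won_mono) fact
  have "?x \<le> M" using assms(6) num_won_le order_trans by blast
  with le have avg: "real ?x' * total_value K v b B \<le> real ?x * total_value K v b' B"
    unfolding total_value_def using assms(5) by (intro average_value_antimono)
  have pr: "price K b' B \<le> price K b B"
    using assms B by (intro price_mono) (auto simp: bid_history_def)
  have feas: "price K b B * real ?x \<le> total_value K v b B"
    using assms(1) B by (auto simp: roi_feasible_def payment_def)
  show "payment K b' B \<le> total_value K v b' B"
  proof (cases "?x = 0")
    case True
    with le show ?thesis by (simp add: payment_def total_value_def)
  next
    case False
    \<comment> \<open>Multiplying by the positive \<open>?x\<close> avoids a division by
      \<open>?x'\<close>, which may be zero; the factor is cancelled at the end.\<close>
    have "real ?x * payment K b' B = price K b' B * (real ?x * real ?x')"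
      by (simp add: payment_def)
    also have "\<dots> \<le> price K b B * (real ?x * real ?x')"
      by (rule mult_right_mono[OF pr]) simp
    also have "\<dots> = real ?x' * (price K b B * real ?x)" by simp
    also have "\<dots> \<le> real ?x' * total_value K v b B"
      by (rule mult_left_mono[OF feas]) simp
    also note avg
    finally show ?thesis using False by simp
  qed
qed

section \<open>Merging a block into its successor\<close>

fun merge_block :: "nat \<Rightarrow> (real \<times> nat) list \<Rightarrow> (real \<times> nat) list" where
  "merge_block i [] = []"
| "merge_block 0 [x] = []"
| "merge_block 0 ((b, q) # (c, r) # s) = (c, q + r) # s"
| "merge_block (Suc i) (x # s) = x # merge_block i s"

lemma bid_vector_Nil [simp]: "bid_vector [] = []"
  by (simp add: bid_vector_def)

lemma bid_vector_Cons [simp]: "bid_vector ((b, q) # s) = replicate q b @ bid_vector s"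
  by (simp add: bid_vector_def)

lemma set_bid_vector: "set (bid_vector s) \<subseteq> fst ` set s"
  by (induction s) (auto simp: bid_vector_def)

lemma sorted_bid_vector:
  assumes "sorted_wrt (>) (map fst s)"
  shows "sorted_wrt (\<ge>) (bid_vector s)"
  using assms
proof (induction s)
  case (Cons x s)
  obtain b q where x: "x = (b, q)" by force
  have "\<forall>c\<in>set (bid_vector s). c \<le> b"
    using Cons.prems set_bid_vector[of s] by (fastforce simp: x)
  moreover have "sorted_wrt (\<ge>) (replicate q b)" by (induction q) auto
  ultimately show ?case using Cons by (auto simp: x sorted_wrt_append)
qed simp

lemma fst_merge_block: "fst ` set (merge_block i s) \<subseteq> fst ` set s"
  by (induction i s rule: merge_block.induct) auto

lemma length_merge_block: "i < length s \<Longrightarrow> length (merge_block i s) = length s - 1"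
proof (induction i s rule: merge_block.induct)
  case (4 i x s)
  then show ?case by (cases s) auto
qed auto

text \<open>Fusing block \<open>i\<close> with its successor, rather than only lowering its bid,
  keeps the bids strictly decreasing. The block count drops by exactly one because \<open>i\<close>
  is a valid index.\<close>

lemma uniform_strategy_merge_block:
  assumes "uniform_strategy M (Suc k) s" and "i < Suc k"
  shows "uniform_strategy M k (merge_block i s)"
proof -
  have "sorted_wrt (>) (map fst s) \<Longrightarrow> sorted_wrt (>) (map fst (merge_block i s))"
  proof (induction i s rule: merge_block.induct)
    case (4 i x s)
    then have "\<forall>y\<in>fst ` set s. y < fst x" by simp
    then have "\<forall>y\<in>fst ` set (merge_block i s). y < fst x"
      using fst_merge_block[of i s] by blast
    with 4 show ?case by auto
  qed auto
  moreover have "\<forall>(b, q)\<in>set s. b > 0 \<and> q > 0 \<Longrightarrow> \<forall>(b, q)\<in>set (merge_block i s). b > 0 \<and> q > 0"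
    by (induction i s rule: merge_block.induct) auto
  moreover have "sum_list (map snd (merge_block i s)) \<le> sum_list (map snd s)"
    by (induction i s rule: merge_block.induct) auto
  ultimately show ?thesis
    using assms length_merge_block[of i s] by (auto simp: uniform_strategy_def)
qed

lemma below_append: "below b' b \<Longrightarrow> below (a @ b') (a @ b)"
  by (auto simp: below_def nth_append)

text \<open>Only the bids of the merged block change: they fall to the smaller bid of the next
  block, or disappear from the end of the vector.\<close>

lemma below_merge_block:
  assumes "sorted_wrt (>) (map fst s)"
  shows "below (bid_vector (merge_block i s)) (bid_vector s)"
  using assms
proof (induction i s rule: merge_block.induct)
  case (3 b q c r s)
  then show ?case by (auto simp: below_def nth_append)
next
  case (4 i x s)
  then show ?case by (cases x) (auto intro: below_append)
qed (auto simp: below_def)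

text \<open>The exception \<open>i0\<close> is the block containing position \<open>j\<close>. No
  other merge moves or changes that bid: fusing preserves the number of bids, deletion happens only
  at the end, and an index past the last block leaves \<open>s\<close> unchanged.\<close>

lemma nth_bid_vector_merge_block:
  assumes "j < length (bid_vector s)"
  shows "\<exists>i0. \<forall>i. i \<noteq> i0 \<longrightarrow> j < length (bid_vector (merge_block i s)) \<and>
           bid_vector (merge_block i s) ! j = bid_vector s ! j"
  using assms
proof (induction s arbitrary: j)
  case (Cons x s)
  obtain b q where x: "x = (b, q)" by force
  show ?case
  proof (cases "j < q")
    case True
    show ?thesis
    proof (intro exI[of _ 0] allI impI)
      fix i :: nat assume "i \<noteq> 0"
      then obtain i' where "i = Suc i'" using not0_implies_Suc by blast
      with True show "j < length (bid_vector (merge_block i (x # s))) \<and>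
           bid_vector (merge_block i (x # s)) ! j = bid_vector (x # s) ! j"
        by (simp add: x nth_append)
    qed
  next
    case False
    then have j: "j - q < length (bid_vector s)" using Cons.prems by (auto simp: x)
    then obtain i0 where i0: "\<And>i. i \<noteq> i0 \<Longrightarrow> j - q < length (bid_vector (merge_block i s)) \<and>
           bid_vector (merge_block i s) ! (j - q) = bid_vector s ! (j - q)"
      using Cons.IH by blast
    show ?thesis
    \<comment> \<open>Block \<open>i0\<close> of the tail is block \<open>Suc i0\<close> of the
      whole list.\<close>
    proof (intro exI[of _ "Suc i0"] allI impI)
      fix i assume i: "i \<noteq> Suc i0"
      show "j < length (bid_vector (merge_block i (x # s))) \<and>
           bid_vector (merge_block i (x # s)) ! j = bid_vector (x # s) ! j"
      proof (cases i)
        case 0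
        \<comment> \<open>Position \<open>j\<close> lies beyond the first block, so there is a next
          block: the first one is fused, not deleted, and nothing shifts.\<close>
        from j obtain c r s' where "s = (c, r) # s'" by (cases s) auto
        with 0 False j show ?thesis
          by (auto simp: x nth_append)
      next
        case (Suc i')
        with i0[of i'] i False show ?thesis by (auto simp: x nth_append)
      qed
    qed
  qed
qed simp

section \<open>Averaging over the choice of the merged block\<close>

lemma sum_total_value_merge_block:
  assumes v: "valuation M v" and s: "uniform_strategy M (Suc k) s"
  shows "real k * total_value K v (bid_vector s) B
           \<le> (\<Sum>i<Suc k. total_value K v (bid_vector (merge_block i s)) B)"
proof -
  let ?V = "\<lambda>s. total_value K v (bid_vector s) B"
  have len: "length (bid_vector (merge_block i s)) \<le> M" if "i < Suc k" for i
    using uniform_strategy_merge_block[OF s that]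
    by (simp add: uniform_strategy_def length_bid_vector)
  have nonneg: "0 \<le> ?V (merge_block i s)" if "i < Suc k" for i
    using total_value_nonneg[OF v len[OF that]] .
  have sort: "sorted_wrt (\<ge>) (bid_vector s)"
    using s by (intro sorted_bid_vector) (simp add: uniform_strategy_def)
  show ?thesis
  proof (cases "num_won K (bid_vector s) B")
    case 0
    then have "?V s = 0" by (simp add: total_value_def)
    moreover have "0 \<le> (\<Sum>i<Suc k. ?V (merge_block i s))" using nonneg by (intro sum_nonneg) auto
    ultimately show ?thesis by simp
  next
    case (Suc n)
    \<comment> \<open>With \<open>Suc n\<close> units won, \<open>n\<close> is the last winning
      position; \<open>i0\<close> below is the only merge that may disturb it.\<close>
    then have "n < length (bid_vector s)" using num_won_le[of K "bid_vector s" B] by simp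
    then obtain i0 where i0: "\<And>i. i \<noteq> i0 \<Longrightarrow> n < length (bid_vector (merge_block i s)) \<and>
           bid_vector (merge_block i s) ! n = bid_vector s ! n"
      using nth_bid_vector_merge_block by blast
    have ge: "?V s \<le> ?V (merge_block i s)" if i: "i < Suc k" "i \<noteq> i0" for i
    proof (intro total_value_mono[OF v len] num_won_ge_if_last_win_kept[OF sort _ Suc])
      show "sorted_wrt (\<ge>) (bid_vector (merge_block i s))"
        using uniform_strategy_merge_block[OF s i(1)]
        by (intro sorted_bid_vector) (simp add: uniform_strategy_def)
    qed (use i i0 in auto)
    have V0: "0 \<le> ?V s"
      using s by (intro total_value_nonneg[OF v]) (simp add: uniform_strategy_def length_bid_vector)
    \<comment> \<open>An inequality suffices, so it does not matter whether \<open>i0\<close> is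
      among the \<open>Suc k\<close> indices.\<close>
    have "k \<le> card ({..<Suc k} - {i0})" by (simp add: card_Diff_singleton_if)
    then have "real k * ?V s \<le> real (card ({..<Suc k} - {i0})) * ?V s"
      using V0 by (intro mult_right_mono) auto
    also have "\<dots> = (\<Sum>i\<in>{..<Suc k} - {i0}. ?V s)" by simp
    also have "\<dots> \<le> (\<Sum>i\<in>{..<Suc k} - {i0}. ?V (merge_block i s))"
      using ge by (intro sum_mono) auto
    also have "\<dots> \<le> (\<Sum>i<Suc k. ?V (merge_block i s))"
      using nonneg by (intro sum_mono2) auto
    finally show ?thesis .
  qed
qed

text \<open>The block to be spared can differ from round to round, while one strategy must serve all
  of them. So the bounds are first summed over the rounds, and only then is an index
  \<open>i\<close> chosen that does at least as well as the average merge.\<close>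

lemma merge_one_block:
  assumes v: "valuation M v" and H: "bid_history H" and K: "K \<ge> 1"
    and s: "uniform_strategy M (Suc k) s" and feas: "roi_feasible K v H (bid_vector s)"
  obtains s' where "uniform_strategy M k s'" and "roi_feasible K v H (bid_vector s')"
    and "real k * history_value K v H (bid_vector s)
           \<le> real (Suc k) * history_value K v H (bid_vector s')"
proof -
  let ?V = "\<lambda>s. history_value K v H (bid_vector s)"
  have swap: "(\<Sum>i<Suc k. ?V (merge_block i s))
      = (\<Sum>B\<leftarrow>H. \<Sum>i<Suc k. total_value K v (bid_vector (merge_block i s)) B)"
    unfolding history_value_def by (induction H) (auto simp: sum.distrib)
  have "real k * ?V s = (\<Sum>B\<leftarrow>H. real k * total_value K v (bid_vector s) B)"
    by (simp add: history_value_def sum_list_const_mult)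
  also have "\<dots> \<le> (\<Sum>i<Suc k. ?V (merge_block i s))"
    unfolding swap by (intro sum_list_mono sum_total_value_merge_block[OF v s])
  finally have sum: "real k * ?V s \<le> (\<Sum>i<Suc k. ?V (merge_block i s))" .
  have "\<exists>i<Suc k. real k * ?V s \<le> real (Suc k) * ?V (merge_block i s)"
  proof (rule ccontr)
    assume "\<not> ?thesis"
    then have "(\<Sum>i<Suc k. real (Suc k) * ?V (merge_block i s)) < (\<Sum>i<Suc k. real k * ?V s)"
      by (intro sum_strict_mono) (auto simp: not_le)
    then have "real (Suc k) * (\<Sum>i<Suc k. ?V (merge_block i s)) < real (Suc k) * (real k * ?V s)"
      by (simp only: sum_distrib_left sum_constant card_lessThan)
    with sum show False by (meson mult_left_mono not_less of_nat_0_le_iff)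
  qed
  then obtain i where i: "i < Suc k" "real k * ?V s \<le> real (Suc k) * ?V (merge_block i s)"
    by blast
  have "\<forall>c\<in>set (bid_vector s). c \<ge> 0"
    using s set_bid_vector[of s] by (fastforce simp: uniform_strategy_def)
  moreover have "below (bid_vector (merge_block i s)) (bid_vector s)"
    using s by (intro below_merge_block) (simp add: uniform_strategy_def)
  moreover have "length (bid_vector s) \<le> M"
    using s by (simp add: uniform_strategy_def length_bid_vector)
  ultimately have "roi_feasible K v H (bid_vector (merge_block i s))"
    using roi_feasible_below[OF feas _ _ H v _ K] by blast
  with i show ?thesis using that uniform_strategy_merge_block[OF s i(1)] by blast
qed

lemma merge_to_fewer_blocks:
  assumes v: "valuation M v" and H: "bid_history H" and K: "K \<ge> 1"
    and "m \<ge> 1" and "m \<le> k"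
    and "uniform_strategy M k s" and "roi_feasible K v H (bid_vector s)"
  shows "\<exists>s'. uniform_strategy M m s' \<and> roi_feasible K v H (bid_vector s') \<and>
    real m * history_value K v H (bid_vector s) \<le> real k * history_value K v H (bid_vector s')"
  using assms(5-7)
proof (induction k arbitrary: s rule: dec_induct)
  case base
  then show ?case by blast
next
  case (step n)
  let ?V = "\<lambda>s. history_value K v H (bid_vector s)"
  from merge_one_block[OF v H K step.prems] obtain s1 where
    s1: "uniform_strategy M n s1" "roi_feasible K v H (bid_vector s1)"
      "real n * ?V s \<le> real (Suc n) * ?V s1" .
  from step.IH[OF s1(1,2)] obtain s2 where
    s2: "uniform_strategy M m s2" "roi_feasible K v H (bid_vector s2)"
      "real m * ?V s1 \<le> real n * ?V s2" by blast
  have "real n * (real m * ?V s) = real m * (real n * ?V s)" by simp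
  also have "\<dots> \<le> real m * (real (Suc n) * ?V s1)"
    by (rule mult_left_mono[OF s1(3)]) simp
  also have "\<dots> = real (Suc n) * (real m * ?V s1)" by simp
  also have "\<dots> \<le> real (Suc n) * (real n * ?V s2)"
    by (rule mult_left_mono[OF s2(3)]) simp
  also have "\<dots> = real n * (real (Suc n) * ?V s2)" by simp
  \<comment> \<open>The common factor \<open>n\<close> is positive because \<open>n\<close> is at
    least \<open>m\<close>, and this cancellation is the telescoping.\<close>
  finally have "real m * ?V s \<le> real (Suc n) * ?V s2"
    using step.hyps \<open>m \<ge> 1\<close> by (auto simp: mult_le_cancel_left)
  with s2 show ?case by blast
qed

section \<open>Comparing the optimal values\<close>

lemma history_value_nonneg:
  assumes "valuation M v" and "b \<in> feasible_class K M v H m"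
  shows "history_value K v H b \<ge> 0"
  unfolding history_value_def using assms
  by (intro sum_list_nonneg)
    (auto simp: feasible_class_def uniform_strategy_def length_bid_vector intro!: total_value_nonneg)

lemma optimal_value_ge:
  assumes "b \<in> feasible_class K M v H m"
  shows "history_value K v H b \<le> optimal_value K M v H m"
  unfolding optimal_value_def using assms by (intro Max_ge finite_history_values) auto

lemma optimal_value_attained:
  assumes "K \<ge> 1" "M \<ge> 1" "m \<ge> 1" "valuation M v"
  obtains b where "b \<in> feasible_class K M v H m" "history_value K v H b = optimal_value K M v H m"
proof -
  have "optimal_value K M v H m \<in> history_value K v H ` feasible_class K M v H m"
    unfolding optimal_value_def using feasible_class_nonempty[OF assms]
    by (intro Max_in finite_history_values) auto
  then show ?thesis using that by force
qed

text \<open>The cross-multiplied form also covers a zero optimum of the smaller class.\<close>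

lemma optimal_value_ratio:
  assumes "K \<ge> 1" "M \<ge> 1" "m \<ge> 1" "m' \<ge> m" and v: "valuation M v" and H: "bid_history H"
  shows "real m * optimal_value K M v H m' \<le> real m' * optimal_value K M v H m"
proof -
  have "m' \<ge> 1" using assms by simp
  from optimal_value_attained[OF assms(1,2) this v] obtain b
    where b: "b \<in> feasible_class K M v H m'"
      and opt: "history_value K v H b = optimal_value K M v H m'" .
  from b obtain s k where s: "b = bid_vector s" "1 \<le> k" "k \<le> m'"
      "uniform_strategy M k s" "roi_feasible K v H (bid_vector s)"
    by (auto simp: feasible_class_def)
  show ?thesis
  proof (cases "k \<le> m")
    \<comment> \<open>With at most \<open>m\<close> blocks the optimal strategy already lies in the
      smaller class; the factor \<open>m' / m\<close> only helps, as values are nonnegative.\<close>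
    case True
    with s have "b \<in> feasible_class K M v H m" by (auto simp: feasible_class_def)
    then have "history_value K v H b \<le> optimal_value K M v H m" by (rule optimal_value_ge)
    with opt history_value_nonneg[OF v b] \<open>m' \<ge> m\<close> show ?thesis
      by (intro mult_mono) auto
  next
    case False
    then obtain s' where s': "uniform_strategy M m s'" "roi_feasible K v H (bid_vector s')"
      "real m * history_value K v H (bid_vector s) \<le> real k * history_value K v H (bid_vector s')"
      using merge_to_fewer_blocks[OF v H assms(1,3) _ s(4,5)] by auto
    then have b': "bid_vector s' \<in> feasible_class K M v H m"
      using assms(3) by (auto simp: feasible_class_def)
    have "real m * optimal_value K M v H m' \<le> real k * history_value K v H (bid_vector s')"
      using s'(3) opt s(1) by simp
    also have "\<dots> \<le> real m' * optimal_value K M v H m"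
      using s(3) optimal_value_ge[OF b'] history_value_nonneg[OF v b'] by (intro mult_mono) auto
    finally show ?thesis .
  qed
qed

theorem mainTheorem11:
  fixes K M m m' :: nat
  assumes "K \<ge> 1" and "M \<ge> 1" and "m \<ge> 1" and "m' \<ge> m"
  shows "Lambda K M m' m \<le> ereal (real m' / real m)"
  unfolding Lambda_def
proof (rule SUP_least, clarify)
  fix v H assume v: "valuation M v" and H: "bid_history H"
  let ?a = "optimal_value K M v H m'" and ?b = "optimal_value K M v H m"
  have nonneg: "optimal_value K M v H n \<ge> 0" if "n \<ge> 1" for n
    using optimal_value_attained[OF assms(1,2) that v] history_value_nonneg[OF v] by metis
  have le: "real m * ?a \<le> real m' * ?b"
    using optimal_value_ratio[OF assms v H] .
  show "value_ratio K M m' m H v \<le> ereal (real m' / real m)"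
  proof (cases "?b = 0")
    case True
    \<comment> \<open>A zero denominator forces a zero numerator, so the quotient is
      \<open>0 / 0\<close>, which is 0 in the extended reals.\<close>
    with le nonneg[of m'] assms have "?a = 0"
      by (simp add: mult_le_0_iff)
    with True show ?thesis by (simp add: value_ratio_def zero_ereal_def[symmetric])
  next
    case False
    with nonneg[of m] assms have "?b > 0" by simp
    with le assms show ?thesis by (simp add: value_ratio_def field_simps)
  qed
qed

end
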